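(* Let $\mathbb{S}$ and $\mathbb{T}$ be algebraic theories and let $\mathbb{U}$ be an algebraic theory that contains both $\mathbb{S}$ and $\mathbb{T}$. Let $X \vdash_{\mathbb{T}} t$ and $X' \vdash_{\mathbb{T}} t'$ be $\mathbb{T}$-terms, and let $\{s_x \mid x \in X\}$ and $\{s'_{x'} \mid x' \in X'\}$ be families of $\mathbb{S}$-terms. The following are equivalent: (1) The separated terms $t[s_x/x]$ and $t'[s'_{x'}/x']$ are equal modulo $(\mathbb{T},\mathbb{S})$. (2) There are a set $Z$ and functions $g_1 : X \to Z$, $g_2 : X' \to Z$ such that: (a) $t[g_1(x)/x] =_{\mathbb{T}} t'[g_2(x')/x']$; (b) for all $x_1,x_2 \in X$: $g_1(x_1) = g_1(x_2)$ if and only if $s_{x_1} =_{\mathbb{S}} s_{x_2}$; (c) for all $x'_1,x'_2 \in X'$: $g_2(x'_1) = g_2(x'_2)$ if and only if $s'_{x'_1} =_{\mathbb{S}} s'_{x'_2}$; (d) for all $x \in X$, $x' \in X'$: $g_1(x) = g_2(x')$ if and only if $s_x =_{\mathbb{S}} s'_{x'}$.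
   Context: An algebraic theory consists of a signature (operation symbols with arities) and a set of equations between terms; $u =_{\mathbb{T}} v$ means the equation is derivable in equational logic from the axioms of $\mathbb{T}$. For a set of variables $Y$, $Y \vdash_{\mathbb{T}} t$ means $t$ is a $\mathbb{T}$-term all of whose variables lie in $Y$. $t[u_x/x]$ denotes simultaneous substitution of $u_x$ for each variable $x$; for a function $g$ on variables, $t[g(x)/x]$ renames each variable $x$ to $g(x)$. A theory $\mathbb{U}$ contains $\mathbb{S}$ and $\mathbb{T}$ if its signature contains both signatures and every equation of $\mathbb{S}$ and of $\mathbb{T}$ is provable in $\mathbb{U}$. A $\mathbb{U}$-term is separated if it has the form $t[s_x/x]$ with $X\vdash_{\mathbb{T}} t$ a $\mathbb{T}$-term and each $s_x$ an $\mathbb{S}$-term. Two separated terms $t[s_x/x]$ (with $X \vdash_{\mathbb T} t$) and $t'[s'_{x'}/x']$ (with $X'\vdash_{\mathbb T} t'$) are equal modulo $(\mathbb{T},\mathbb{S})$ if there exist a set $Y$, functions $f : X \to Y$, $f' : X' \to Y$ and $\mathbb{S}$-terms $\bar{s}_y$ ($y\in Y$) such that $t[f(x)/x] =_{\mathbb{T}} t'[f'(x')/x']$, $s_x =_{\mathbb{S}} \bar{s}_{f(x)}$ for all $x \in X$, and $s'_{x'} =_{\mathbb{S}} \bar{s}_{f'(x')}$ for all $x' \in X'$. *)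

theory Defs
  imports "HOL-Library.FuncSet" "HOL-Library.Infinite_Typeclass"
begin

datatype (syms: 'f, vars: 'v) trm = Var 'v | Op 'f "('f, 'v) trm list"

text \<open>Simultaneous substitution; \<open>rename g t\<close> replaces each variable \<open>x\<close> by the variable \<open>g x\<close>.\<close>

primrec subst :: "('v \<Rightarrow> ('f, 'v) trm) \<Rightarrow> ('f, 'v) trm \<Rightarrow> ('f, 'v) trm" where
  "subst \<sigma> (Var x) = \<sigma> x"
| "subst \<sigma> (Op f ts) = Op f (map (subst \<sigma>) ts)"

definition rename :: "('v \<Rightarrow> 'v) \<Rightarrow> ('f, 'v) trm \<Rightarrow> ('f, 'v) trm" where
  "rename g t = subst (\<lambda>x. Var (g x)) t"

text \<open>The signature consists of the symbols in \<open>ops\<close>; the value of \<open>arity\<close> at symbols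
  outside \<open>ops\<close> is irrelevant.\<close>

record ('f, 'v) alg_theory =
  ops :: "'f set"
  arity :: "'f \<Rightarrow> nat"
  axms :: "(('f, 'v) trm \<times> ('f, 'v) trm) set"

fun is_term :: "('f, 'v) alg_theory \<Rightarrow> ('f, 'v) trm \<Rightarrow> bool" where
  "is_term T (Var x) = True"
| "is_term T (Op f ts) = (f \<in> ops T \<and> length ts = arity T f \<and> (\<forall>t\<in>set ts. is_term T t))"

definition is_theory :: "('f, 'v) alg_theory \<Rightarrow> bool" where
  "is_theory T \<longleftrightarrow> (\<forall>(u, v)\<in>axms T. is_term T u \<and> is_term T v)"

definition term_in :: "('f, 'v) alg_theory \<Rightarrow> 'v set \<Rightarrow> ('f, 'v) trm \<Rightarrow> bool" where
  "term_in T Y t \<longleftrightarrow> is_term T t \<and> vars t \<subseteq> Y"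

inductive provable :: "('f, 'v) alg_theory \<Rightarrow> ('f, 'v) trm \<Rightarrow> ('f, 'v) trm \<Rightarrow> bool"
  for T :: "('f, 'v) alg_theory" where
  ax: "(u, v) \<in> axms T \<Longrightarrow> provable T u v"
| refl: "is_term T u \<Longrightarrow> provable T u u"
| sym: "provable T u v \<Longrightarrow> provable T v u"
| trans: "provable T u v \<Longrightarrow> provable T v w \<Longrightarrow> provable T u w"
| cong: "f \<in> ops T \<Longrightarrow> length us = arity T f \<Longrightarrow> list_all2 (provable T) us vs \<Longrightarrow>
    provable T (Op f us) (Op f vs)"
| inst: "provable T u v \<Longrightarrow> (\<And>x. is_term T (\<sigma> x)) \<Longrightarrow> provable T (subst \<sigma> u) (subst \<sigma> v)"

definition contains :: "('f, 'v) alg_theory \<Rightarrow> ('f, 'v) alg_theory \<Rightarrow> bool" where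
  "contains U S \<longleftrightarrow>
     ops S \<subseteq> ops U \<and> (\<forall>f\<in>ops S. arity U f = arity S f) \<and> (\<forall>(u, v)\<in>axms S. provable U u v)"

text \<open>Equality modulo \<open>(T, S)\<close> of the separated terms \<open>subst s t\<close> and \<open>subst s' t'\<close>. The notion
  refers to the chosen decompositions \<open>(X, t, s)\<close> and \<open>(X', t', s')\<close>, not only to the
  composite terms, so these are the arguments. Only the values of \<open>s\<close> on \<open>X\<close> matter, and only
  those of \<open>s'\<close> on \<open>X'\<close>.

  All sets of variables, including the existentially quantified \<open>Y\<close>, are subsets of one variable
  type. If that type is infinite, this is no restriction on \<open>Y\<close>: only the images of \<open>f\<close> and \<open>f'\<close>
  matter, and their union embeds into \<open>'v\<close>.\<close>

definition equal_modulo ::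
  "('f, 'v) alg_theory \<Rightarrow> ('f, 'v) alg_theory \<Rightarrow>
   'v set \<Rightarrow> ('f, 'v) trm \<Rightarrow> ('v \<Rightarrow> ('f, 'v) trm) \<Rightarrow>
   'v set \<Rightarrow> ('f, 'v) trm \<Rightarrow> ('v \<Rightarrow> ('f, 'v) trm) \<Rightarrow> bool" where
  "equal_modulo T S X t s X' t' s' \<longleftrightarrow>
     (\<exists>(Y :: 'v set) f f' sbar.
        f \<in> X \<rightarrow> Y \<and> f' \<in> X' \<rightarrow> Y \<and> (\<forall>y\<in>Y. is_term S (sbar y)) \<and>
        provable T (rename f t) (rename f' t') \<and>
        (\<forall>x\<in>X. provable S (s x) (sbar (f x))) \<and>
        (\<forall>x'\<in>X'. provable S (s' x') (sbar (f' x'))))"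

end

theory Submission
  imports Defs
begin

text \<open>Both conditions say that \<open>t\<close> and \<open>t'\<close> become provably equal after variables with provably
  equal \<open>S\<close>-terms may be identified. Given \<open>f\<close>, \<open>f'\<close> and \<open>sbar\<close>, postcompose \<open>f\<close> and \<open>f'\<close> with a map
  choosing one index from each \<open>S\<close>-provability class of the family \<open>sbar\<close>; provability in \<open>T\<close> survives
  this renaming. Conversely, \<open>g1\<close> and \<open>g2\<close> identify variables only if their \<open>S\<close>-terms are
  provably equal, so a representative \<open>S\<close>-term can be chosen for each element of their images.\<close>

lemma subst_subst: "subst \<sigma> (subst \<tau> t) = subst (\<lambda>x. subst \<sigma> (\<tau> x)) t"
  by (induction t) auto

lemma rename_rename: "rename h (rename g t) = rename (h \<circ> g) t"
  by (simp add: rename_def subst_subst)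

lemma provable_rename: "provable T u v \<Longrightarrow> provable T (rename h u) (rename h v)"
  unfolding rename_def by (rule provable.inst) auto

text \<open>Provably equal terms have the same provable partners, so \<open>SOME\<close> is applied
  to the same predicate and returns the same index. Conversely, each term is provably equal to the
  one at its chosen index; reflexivity, hence \<open>is_term\<close>, guarantees that a candidate
  exists.\<close>

lemma some_provable_eq_iff:
  assumes "is_term S (r x)" and "is_term S (r y)"
  shows "(SOME z. provable S (r x) (r z)) = (SOME z. provable S (r y) (r z))
    \<longleftrightarrow> provable S (r x) (r y)"
    (is "?h x = ?h y \<longleftrightarrow> _")
proof
  have h: "provable S (r a) (r (?h a))" if "is_term S (r a)" for a
    using that by (intro someI[of "\<lambda>z. provable S (r a) (r z)" a] provable.refl)
  assume "?h x = ?h y"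
  then show "provable S (r x) (r y)"
    using h[OF assms(1)] h[OF assms(2)] by (metis provable.sym provable.trans)
next
  assume "provable S (r x) (r y)"
  then have "provable S (r x) (r z) \<longleftrightarrow> provable S (r y) (r z)" for z
    by (blast intro: provable.sym provable.trans)
  then show "?h x = ?h y" by simp
qed

lemma provable_cong:
  assumes "provable S u u'" and "provable S v v'"
  shows "provable S u v \<longleftrightarrow> provable S u' v'"
  using assms by (blast intro: provable.sym provable.trans)

theorem theorem2p20:
  fixes S T U :: "('f, 'v::infinite) alg_theory"
    and X X' :: "'v set"
    and t t' :: "('f, 'v) trm"
    and s s' :: "'v \<Rightarrow> ('f, 'v) trm"
  assumes "is_theory S" and "is_theory T" and "is_theory U"
    and "contains U S" and "contains U T"
    and "term_in T X t" and "term_in T X' t'"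
    and "\<forall>x\<in>X. is_term S (s x)" and "\<forall>x'\<in>X'. is_term S (s' x')"
  shows "equal_modulo T S X t s X' t' s' \<longleftrightarrow>
    (\<exists>(Z :: 'v set) g1 g2.
       g1 \<in> X \<rightarrow> Z \<and> g2 \<in> X' \<rightarrow> Z \<and>
       provable T (rename g1 t) (rename g2 t') \<and>
       (\<forall>x1\<in>X. \<forall>x2\<in>X. g1 x1 = g1 x2 \<longleftrightarrow> provable S (s x1) (s x2)) \<and>
       (\<forall>x1'\<in>X'. \<forall>x2'\<in>X'. g2 x1' = g2 x2' \<longleftrightarrow> provable S (s' x1') (s' x2')) \<and>
       (\<forall>x\<in>X. \<forall>x'\<in>X'. g1 x = g2 x' \<longleftrightarrow> provable S (s x) (s' x')))"
    (is "_ \<longleftrightarrow> ?R")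
proof
  assume "equal_modulo T S X t s X' t' s'"
  then obtain Y f f' sbar where f: "f \<in> X \<rightarrow> Y" "f' \<in> X' \<rightarrow> Y"
    and sbar: "\<forall>y\<in>Y. is_term S (sbar y)"
    and eq: "provable T (rename f t) (rename f' t')"
    and s: "\<forall>x\<in>X. provable S (s x) (sbar (f x))"
    and s': "\<forall>x'\<in>X'. provable S (s' x') (sbar (f' x'))"
    unfolding equal_modulo_def by blast
  define h where "h y = (SOME z. provable S (sbar y) (sbar z))" for y
  have h: "h y1 = h y2 \<longleftrightarrow> provable S (sbar y1) (sbar y2)" if "y1 \<in> Y" "y2 \<in> Y" for y1 y2
    unfolding h_def using that sbar by (intro some_provable_eq_iff) auto
  have "provable T (rename (h \<circ> f) t) (rename (h \<circ> f') t')"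
    using provable_rename[OF eq, of h] by (simp add: rename_rename)
  \<comment> \<open>By \<open>provable_cong\<close>, provability between \<open>S\<close>-terms of
    the families transfers to the corresponding \<open>sbar\<close> terms, where equality of
    \<open>h\<close>-values decides it. The same argument gives (c) and (d).\<close>
  moreover have "(h \<circ> f) x1 = (h \<circ> f) x2 \<longleftrightarrow> provable S (s x1) (s x2)"
    if "x1 \<in> X" "x2 \<in> X" for x1 x2
    using that f s h provable_cong[of S "s x1" "sbar (f x1)" "s x2" "sbar (f x2)"]
    by (auto simp: Pi_iff)
  moreover have "(h \<circ> f') x1 = (h \<circ> f') x2 \<longleftrightarrow> provable S (s' x1) (s' x2)"
    if "x1 \<in> X'" "x2 \<in> X'" for x1 x2
    using that f s' h provable_cong[of S "s' x1" "sbar (f' x1)" "s' x2" "sbar (f' x2)"]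
    by (auto simp: Pi_iff)
  moreover have "(h \<circ> f) x = (h \<circ> f') x' \<longleftrightarrow> provable S (s x) (s' x')"
    if "x \<in> X" "x' \<in> X'" for x x'
    using that f s s' h provable_cong[of S "s x" "sbar (f x)" "s' x'" "sbar (f' x')"]
    by (auto simp: Pi_iff)
  \<comment> \<open>The index chosen by \<open>h\<close> ranges over all variables and may lie
    outside \<open>Y\<close>, hence \<open>UNIV\<close> as \<open>Z\<close>.\<close>
  ultimately show ?R
    by (intro exI[of _ UNIV] exI[of _ "h \<circ> f"] exI[of _ "h \<circ> f'"]) blast
next
  assume ?R
  then obtain g1 g2 :: "'v \<Rightarrow> 'v" where eq: "provable T (rename g1 t) (rename g2 t')"
    and g1: "\<forall>x1\<in>X. \<forall>x2\<in>X. g1 x1 = g1 x2 \<longleftrightarrow> provable S (s x1) (s x2)"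
    and g2: "\<forall>x1\<in>X'. \<forall>x2\<in>X'. g2 x1 = g2 x2 \<longleftrightarrow> provable S (s' x1) (s' x2)"
    and g12: "\<forall>x\<in>X. \<forall>x'\<in>X'. g1 x = g2 x' \<longleftrightarrow> provable S (s x) (s' x')"
    by blast
  \<comment> \<open>On the overlap of the two images the \<open>s\<close>-term takes precedence;
    elements outside both images are left out of \<open>Y\<close> below, so the value there is
    immaterial.\<close>
  define sbar where "sbar y =
    (if y \<in> g1 ` X then s (inv_into X g1 y) else s' (inv_into X' g2 y))" for y
  have "is_term S (sbar y)" if "y \<in> g1 ` X \<union> g2 ` X'" for y
    using that assms(8,9) inv_into_into[of y g1 X] inv_into_into[of y g2 X']
    unfolding sbar_def by auto
  moreover have "provable S (s x) (sbar (g1 x))" if "x \<in> X" for x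
  proof -
    \<comment> \<open>The chosen preimage may differ from \<open>x\<close> but has the same
      \<open>g1\<close>-value, so (b) applies.\<close>
    have "inv_into X g1 (g1 x) \<in> X" "g1 (inv_into X g1 (g1 x)) = g1 x"
      using that by (auto intro: inv_into_into f_inv_into_f)
    then have "provable S (s x) (s (inv_into X g1 (g1 x)))"
      using g1 that by metis
    then show ?thesis using that by (simp add: sbar_def)
  qed
  moreover have "provable S (s' x') (sbar (g2 x'))" if x': "x' \<in> X'" for x'
  \<comment> \<open>On the overlap \<open>sbar\<close> returns an \<open>s\<close>-term, which (d)
    relates to \<open>s' x'\<close>; elsewhere (c) suffices.\<close>
  proof (cases "g2 x' \<in> g1 ` X")
    case True
    then have "provable S (s (inv_into X g1 (g2 x'))) (s' x')"
      using g12 x' by (metis inv_into_into f_inv_into_f)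
    then show ?thesis using True by (simp add: sbar_def provable.sym)
  next
    case False
    have "inv_into X' g2 (g2 x') \<in> X'" "g2 (inv_into X' g2 (g2 x')) = g2 x'"
      using x' by (auto intro: inv_into_into f_inv_into_f)
    then have "provable S (s' x') (s' (inv_into X' g2 (g2 x')))"
      using g2 x' by metis
    then show ?thesis using False by (simp add: sbar_def)
  qed
  ultimately show "equal_modulo T S X t s X' t' s'"
    unfolding equal_modulo_def using eq
    by (intro exI[of _ "g1 ` X \<union> g2 ` X'"] exI[of _ g1] exI[of _ g2] exI[of _ sbar]) auto
qed

end
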